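(* Let $n\ge2$ be an integer, let $p\in[1/n,\,1-1/n]$, and let $Y$ be a binomial random variable, $Y\sim\operatorname{Bin}(n,p)$. Then $$\sqrt{np(1-p)/2}\;\le\;\mathbb{E}\left|Y-np\right|\;\le\;\sqrt{np(1-p)}.$$
   Context: $\operatorname{Bin}(n,p)$ denotes the binomial distribution with $n$ trials and success probability $p$. *)

theory Defs
  imports "HOL-Probability.Probability"
begin

end

theory Submission
  imports Defs
begin

text \<open>
  Put \<open>q = 1 - p\<close> and \<open>T j = j (n choose j) p^j q^(n + 1 - j)\<close>. De Moivre's identity
  \<open>(j - n p) (n choose j) p^j q^(n - j) = T j - T (j + 1)\<close> telescopes and gives
  \<open>E |Y - n p| = 2 T K\<close> whenever \<open>K - 1 \<le> n p \<le> K\<close>. For fixed \<open>K\<close>, the function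
  \<open>(T K)^2 / (n p q)\<close> is log-concave in \<open>p\<close>, hence minimal on \<open>[(K - 1) / n, K / n]\<close> at an end
  point. At \<open>p = k / n\<close>, with \<open>m = n - k\<close>, the lower bound becomes
  \<open>8 (k + m choose k)^2 k^(2 k + 1) m^(2 m + 1) \<ge> (k + m)^(2 (k + m) + 1)\<close>. This is an equality
  for \<open>k = m = 1\<close>, and the ratio of the two sides increases in \<open>k\<close> and in \<open>m\<close> because
  \<open>(1 + 1 / x)^(2 x + 1)\<close> decreases in \<open>x\<close>.
  For the upper bound, take expectations in \<open>2 \<sigma> |x| \<le> x^2 + \<sigma>^2\<close> with
  \<open>x = Y - n p\<close> and \<open>\<sigma>^2 = n p q\<close>.
\<close>

section \<open>The probability of the mode of a binomial distribution with integer mean\<close>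

lemma ln_add_one_minus_ln_le:
  fixes x :: real
  assumes "0 < x"
  shows "ln (x + 1) - ln x \<le> (2 * x + 1) / (2 * x * (x + 1))"
proof -
  \<comment> \<open>\<open>f\<close> vanishes at 1 and has derivative ((u - 1) / u)^2, so it is
    nonnegative at u = 1 + 1/x.\<close>
  define f where "f = (\<lambda>u::real. u - 1 / u - 2 * ln u)"
  have "f 1 \<le> f ((x + 1) / x)"
  proof (rule DERIV_nonneg_imp_nondecreasing[where f = f])
    show "1 \<le> (x + 1) / x" using assms by (simp add: field_simps)
  next
    fix u :: real
    assume u: "1 \<le> u"
    have "(f has_real_derivative (u - 1)\<^sup>2 / u\<^sup>2) (at u)"
      unfolding f_def using u
      by (auto intro!: derivative_eq_intros simp: field_simps power2_eq_square)
    then show "\<exists>y. (f has_real_derivative y) (at u) \<and> 0 \<le> y"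
      by (intro exI[of _ "(u - 1)\<^sup>2 / u\<^sup>2"]) simp
  qed
  then have "2 * ln ((x + 1) / x) \<le> (x + 1) / x - x / (x + 1)"
    by (simp add: f_def)
  also have "\<dots> = 2 * ((2 * x + 1) / (2 * x * (x + 1)))"
    using assms by (simp add: divide_simps) (simp add: algebra_simps)
  finally have "ln ((x + 1) / x) \<le> (2 * x + 1) / (2 * x * (x + 1))"
    by linarith
  then show ?thesis
    using assms by (simp add: ln_div)
qed

text \<open>The logarithm \<open>g\<close> of (1 + 1/t)^(2t + 1) has derivative 2 (ln (t + 1) - ln
  t) - (2t + 1) / (t (t + 1)), nonpositive by the previous lemma. The comparison of the values at
  \<open>x\<close> and \<open>y\<close> is cleared of denominators.\<close>

lemma power_ratio_antimono:
  fixes x y :: nat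
  assumes "0 < x" and "x \<le> y"
  shows "real x ^ (2 * x + 1) * real (y + 1) ^ (2 * y + 1)
    \<le> real (x + 1) ^ (2 * x + 1) * real y ^ (2 * y + 1)"
proof -
  define g where "g = (\<lambda>t::real. (2 * t + 1) * (ln (t + 1) - ln t))"
  have "g (real y) \<le> g (real x)"
  proof (rule DERIV_nonpos_imp_nonincreasing[where f = g])
    show "real x \<le> real y" using assms by simp
  next
    fix t :: real
    assume "real x \<le> t"
    with assms have t: "0 < t" by linarith
    let ?d = "2 * (ln (t + 1) - ln t) + (2 * t + 1) * (1 / (t + 1) - 1 / t)"
    have "(g has_real_derivative ?d) (at t)"
      unfolding g_def using t by (auto intro!: derivative_eq_intros)
    moreover define w where "w = (2 * t + 1) / (2 * t * (t + 1))"
    have "(2 * t + 1) * (1 / (t + 1) - 1 / t) = - 2 * w"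
      unfolding w_def using t by (simp add: divide_simps) (simp add: algebra_simps)
    with ln_add_one_minus_ln_le[OF t, folded w_def] have "?d \<le> 0" by simp
    ultimately show "\<exists>z. (g has_real_derivative z) (at t) \<and> z \<le> 0" by blast
  qed
  then have "(2 * x + 1) * ln (real x) + (2 * y + 1) * ln (real (y + 1))
      \<le> (2 * x + 1) * ln (real (x + 1)) + (2 * y + 1) * ln (real y)"
    by (simp add: g_def algebra_simps)
  then have "ln (real x ^ (2 * x + 1) * real (y + 1) ^ (2 * y + 1))
      \<le> ln (real (x + 1) ^ (2 * x + 1) * real y ^ (2 * y + 1))"
    using assms by (simp add: ln_mult ln_realpow del: power_Suc of_nat_Suc)
  then show ?thesis
    using assms by (subst (asm) ln_le_cancel_iff) (auto simp del: power_Suc of_nat_Suc)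
qed

text \<open>For positive \<open>k\<close> and \<open>m\<close>, with n = k + m, p = k/n and q = m/n,
  this says that Bin(n, p) takes its mode \<open>k\<close> with probability at least 1 / sqrt (8 n p
  q).\<close>

definition binomial_mode_bound :: "nat \<Rightarrow> nat \<Rightarrow> bool" where
  "binomial_mode_bound k m \<longleftrightarrow>
    real (k + m) ^ (2 * (k + m) + 1)
      \<le> 8 * real ((k + m) choose k) ^ 2 * real k ^ (2 * k + 1) * real m ^ (2 * m + 1)"

lemma binomial_mode_bound_commute:
  "binomial_mode_bound k m \<longleftrightarrow> binomial_mode_bound m k"
proof -
  have "(k + m) choose k = (m + k) choose m"
    using binomial_symmetric[of k "k + m"] by (simp add: add.commute)
  then show ?thesis
    by (simp add: binomial_mode_bound_def add.commute mult.assoc mult.left_commute del: power_Suc)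
       (simp add: mult_ac)
qed

text \<open>Passing to \<open>Suc k\<close> multiplies the quotient of right side by left side by (1
  + 1/k)^(2k + 1) / (1 + 1/s)^(2s + 1), where s = k + m. This is at least 1 because k <= s.\<close>

lemma binomial_mode_bound_Suc:
  assumes "0 < k" and "binomial_mode_bound k m"
  shows "binomial_mode_bound (Suc k) m"
proof -
  define s where "s = k + m"
  define c where "c = 8 * real (s choose k) ^ 2 * real m ^ (2 * m + 1)"
  have c: "0 \<le> c" by (simp add: c_def)
  have s: "0 < s" using assms by (simp add: s_def)
  have "real s ^ (2 * s + 1) * real (s + 1) ^ (2 * s + 1)
      \<le> c * real k ^ (2 * k + 1) * real (s + 1) ^ (2 * s + 1)"
    using assms(2) unfolding binomial_mode_bound_def c_def s_def
    by (intro mult_right_mono) (simp_all add: mult_ac)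
  also have "\<dots> \<le> c * (real (k + 1) ^ (2 * k + 1) * real s ^ (2 * s + 1))"
    using mult_left_mono[OF power_ratio_antimono[of k s] c] assms by (simp add: s_def mult.assoc)
  finally have "real s ^ (2 * s + 1) * real (s + 1) ^ (2 * s + 1)
      \<le> real s ^ (2 * s + 1) * (c * real (k + 1) ^ (2 * k + 1))"
    by (simp only: mult_ac)
  then have "real (s + 1) ^ (2 * s + 1) \<le> c * real (k + 1) ^ (2 * k + 1)"
    using s by (subst (asm) mult_le_cancel_left_pos) (auto simp del: power_Suc)
  \<comment> \<open>The extra square feeds the absorption identity for the binomial coefficient and
    raises the left exponent to 2 (s + 1) + 1.\<close>
  then have "real (s + 1) ^ 2 * real (s + 1) ^ (2 * s + 1)
      \<le> real (s + 1) ^ 2 * (c * real (k + 1) ^ (2 * k + 1))"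
    by (intro mult_left_mono) auto
  also have "\<dots> = 8 * (real (s + 1) * real (s choose k)) ^ 2
      * real (k + 1) ^ (2 * k + 1) * real m ^ (2 * m + 1)"
    by (simp only: c_def power_mult_distrib mult_ac)
  also have "real (s + 1) * real (s choose k) = real (k + 1) * real (Suc s choose Suc k)"
    using Suc_times_binomial[of k s] by (metis of_nat_mult Suc_eq_plus1)
  also have "8 * (real (k + 1) * real (Suc s choose Suc k)) ^ 2
      * real (k + 1) ^ (2 * k + 1) * real m ^ (2 * m + 1)
      = 8 * real (Suc s choose Suc k) ^ 2
        * (real (k + 1) ^ 2 * real (k + 1) ^ (2 * k + 1)) * real m ^ (2 * m + 1)"
    by (simp only: power_mult_distrib mult_ac)
  finally have "real (s + 1) ^ 2 * real (s + 1) ^ (2 * s + 1) \<le> \<dots>" .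
  moreover have "real a ^ 2 * real a ^ (2 * b + 1) = real a ^ (2 * Suc b + 1)" for a b :: nat
    by (simp flip: power_add)
  ultimately show ?thesis
    unfolding binomial_mode_bound_def by (simp only: s_def Suc_eq_plus1 add_ac)
qed

lemma binomial_mode_bound:
  assumes "0 < k" and "0 < m"
  shows "binomial_mode_bound k m"
proof -
  \<comment> \<open>Only the first argument grows here: (1, 1) leads to (m, 1), symmetry to (1, m),
    and a second use to (k, m).\<close>
  have step: "binomial_mode_bound k m" if "0 < k" and "binomial_mode_bound 1 m" for k m
    using that by (induction k rule: nat_induct_non_zero) (auto intro: binomial_mode_bound_Suc)
  have "binomial_mode_bound 1 1"
    by (simp add: binomial_mode_bound_def numeral_eq_Suc)
  then show ?thesis
    using step assms binomial_mode_bound_commute by blast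
qed

section \<open>De Moivre's formula for the mean absolute deviation\<close>

lemma binomial_expectation_eq_Bernstein_sum:
  fixes f :: "nat \<Rightarrow> real"
  assumes "0 \<le> p" and "p \<le> 1"
  shows "measure_pmf.expectation (binomial_pmf n p) f = (\<Sum>j\<le>n. f j * Bernstein n j p)"
  using assms by (simp add: expectation_binomial_pmf' Bernstein_def mult_ac)

text \<open>The factor \<open>j\<close> and the binomial coefficient make this vanish at j = 0 and j
  = n + 1, the two ends of the telescoping sums. The truncated subtraction is exact up to j = n +
  1.\<close>

definition de_Moivre_term :: "nat \<Rightarrow> real \<Rightarrow> nat \<Rightarrow> real" where
  "de_Moivre_term n p j = real j * real (n choose j) * p ^ j * (1 - p) ^ (n + 1 - j)"

text \<open>Writing B for \<open>Bernstein n j p\<close>, the two terms are j (1 - p) B and, by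
  absorption, (n - j) p B. Their difference is (j - n p) B.\<close>

lemma Bernstein_telescope:
  assumes "j \<le> n"
  shows "(real j - real n * p) * Bernstein n j p
    = de_Moivre_term n p j - de_Moivre_term n p (Suc j)"
proof -
  have "real (Suc j) * real (n choose Suc j) = (real n - real j) * real (n choose j)"
  proof (cases "j = n")
    case False
    then have "Suc j * (n choose Suc j) = (n - j) * (n choose j)"
      using assms binomial_absorb_comp[of n j] binomial_absorption[of j n] by simp
    then show ?thesis
      using assms by (metis of_nat_diff of_nat_mult)
  qed simp
  then have "de_Moivre_term n p (Suc j)
      = (real n - real j) * real (n choose j) * p ^ Suc j * (1 - p) ^ (n - j)"
    by (simp add: de_Moivre_term_def)
  moreover have "de_Moivre_term n p j
      = real j * real (n choose j) * p ^ j * ((1 - p) * (1 - p) ^ (n - j))"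
    using assms by (simp add: de_Moivre_term_def Suc_diff_le)
  ultimately show ?thesis
    by (simp add: Bernstein_def algebra_simps)
qed

text \<open>The deviation j - n p is nonpositive for j < K and nonnegative from \<open>K\<close> on,
  so each half telescopes to the term at \<open>K\<close>.\<close>

lemma binomial_mean_absolute_deviation:
  assumes "K \<le> Suc n" and "real K - 1 \<le> real n * p" and "real n * p \<le> real K"
  shows "(\<Sum>j\<le>n. \<bar>real j - real n * p\<bar> * Bernstein n j p) = 2 * de_Moivre_term n p K"
proof -
  let ?T = "de_Moivre_term n p"
  have low: "\<bar>real j - real n * p\<bar> * Bernstein n j p = ?T (Suc j) - ?T j" if "j < K" for j
  proof -
    have "real j \<le> real n * p" using that assms by linarith
    then show ?thesis
      using Bernstein_telescope[of j n p] that assms by (simp add: algebra_simps)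
  qed
  have high: "\<bar>real j - real n * p\<bar> * Bernstein n j p = ?T j - ?T (Suc j)"
    if "K \<le> j" "j \<le> n" for j
  proof -
    have "real n * p \<le> real j" using that assms by linarith
    then show ?thesis
      using Bernstein_telescope[of j n p] that by simp
  qed
  have "(\<Sum>j\<le>n. \<bar>real j - real n * p\<bar> * Bernstein n j p)
      = (\<Sum>j<K. \<bar>real j - real n * p\<bar> * Bernstein n j p)
        + (\<Sum>j=K..<Suc n. \<bar>real j - real n * p\<bar> * Bernstein n j p)"
    using sum.atLeastLessThan_concat
      [of 0 K "Suc n" "\<lambda>j. \<bar>real j - real n * p\<bar> * Bernstein n j p"] assms(1)
    by (simp add: lessThan_atLeast0 atLeast0AtMost atLeastLessThanSuc_atLeastAtMost)
  also have "\<dots> = (\<Sum>j<K. ?T (Suc j) - ?T j) + (\<Sum>j=K..<Suc n. ?T j - ?T (Suc j))"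
    using low high by (intro arg_cong2[of _ _ _ _ "(+)"] sum.cong) auto
  also have "(\<Sum>j<K. ?T (Suc j) - ?T j) = ?T K - ?T 0"
    by (rule sum_lessThan_telescope)
  also have "(\<Sum>j=K..<Suc n. ?T j - ?T (Suc j)) = ?T K - ?T (Suc n)"
    using sum_Suc_diff'[of K "Suc n" "\<lambda>j. - ?T j"] assms(1) by simp
  finally show ?thesis
    by (simp add: de_Moivre_term_def)
qed

section \<open>The lower bound between consecutive multiples of 1/n\<close>

lemma min_le_power_mult_power:
  fixes a b c p :: real
  assumes "0 < a" "b < 1" "a \<le> p" "p \<le> b" "0 < c"
    and "c \<le> a ^ r * (1 - a) ^ s" and "c \<le> b ^ r * (1 - b) ^ s"
  shows "c \<le> p ^ r * (1 - p) ^ s"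
proof -
  \<comment> \<open>\<open>L\<close> is concave as a combination of ln x and ln (1 - x), so a lower
    bound at both end points persists in between.\<close>
  define L where "L = (\<lambda>x::real. real r * ln x + real s * ln (1 - x))"
  have L: "L x = ln (x ^ r * (1 - x) ^ s)" if "0 < x" "x < 1" for x
    using that by (simp add: L_def ln_mult ln_realpow)
  have "p \<in> closed_segment a b"
    using assms by (simp add: closed_segment_eq_real_ivl)
  then obtain t where t: "0 \<le> t" "t \<le> 1" and p: "p = (1 - t) * a + t * b"
    by (auto simp: in_segment)
  have ln_concave: "(1 - t) * ln x + t * ln y \<le> ln ((1 - t) * x + t * y)" if "0 < x" "0 < y"
    for x y :: real
    using concave_onD[OF ln_concave, of t x y] t that by simp
  have "(1 - t) * ln (1 - a) + t * ln (1 - b) \<le> ln ((1 - t) * (1 - a) + t * (1 - b))"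
    using assms by (intro ln_concave) auto
  also have "(1 - t) * (1 - a) + t * (1 - b) = 1 - p"
    by (simp add: p algebra_simps)
  finally have "real s * ((1 - t) * ln (1 - a) + t * ln (1 - b)) \<le> real s * ln (1 - p)"
    by (intro mult_left_mono) auto
  moreover have "real r * ((1 - t) * ln a + t * ln b) \<le> real r * ln p"
    using ln_concave[of a b] assms by (intro mult_left_mono) (auto simp: p)
  ultimately have "(1 - t) * L a + t * L b \<le> L p"
    by (simp add: L_def algebra_simps)
  moreover have "(1 - t) * ln c \<le> (1 - t) * L a" "t * ln c \<le> t * L b"
    using assms t by (auto intro!: mult_left_mono simp: L)
  ultimately have "ln c \<le> L p"
    by (simp add: algebra_simps)
  then show ?thesis
    using assms by (simp add: L)
qed

text \<open>Squaring and dividing by n p (1 - p) turns the claim into n <= A p^r (1 - p)^s. By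
  log-concavity this need only be checked at p = K/n and p = (K - 1)/n.\<close>

lemma de_Moivre_term_lower_bound:
  assumes "0 < K" "K < n" "1 \<le> real n * p" "real K - 1 \<le> real n * p" "real n * p \<le> real K"
  shows "sqrt (real n * p * (1 - p) / 2) \<le> 2 * de_Moivre_term n p K"
proof -
  define A where "A = 8 * (real K * real (n choose K))\<^sup>2"
  define r where "r = 2 * K - 1"
  define s where "s = 2 * (n - K) + 1"
  have n: "0 < real n" using assms by simp
  have A: "0 < A" using assms by (simp add: A_def)
  \<comment> \<open>The exponents \<open>r\<close> and \<open>s\<close> are tied to
    \<open>K\<close>, whereas \<open>k\<close> will be \<open>K\<close> or K - 1; the last premise
    matches them with those of the mode bound at \<open>k\<close>.\<close>
  have bound_of_mode: "real n / A \<le> (real k / n) ^ r * (1 - real k / n) ^ s"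
    if "0 < k" "k < n" and "A * real k ^ r * real (n - k) ^ s
      = 8 * real (n choose k) ^ 2 * real k ^ (2 * k + 1) * real (n - k) ^ (2 * (n - k) + 1)" for k
  proof -
    have rs: "r + s = 2 * n" using assms by (simp add: r_def s_def)
    have "real n * real n ^ (r + s) \<le> A * real k ^ r * real (n - k) ^ s"
      using binomial_mode_bound[of k "n - k"] that by (simp add: binomial_mode_bound_def rs)
    then have "real n / A \<le> real k ^ r * real (n - k) ^ s / real n ^ (r + s)"
      using A n by (simp add: field_simps)
    also have "\<dots> = (real k / n) ^ r * (real (n - k) / n) ^ s"
      by (simp add: power_divide power_add)
    also have "real (n - k) / n = 1 - real k / n"
      using that n by (simp add: of_nat_diff field_simps)
    finally show ?thesis .
  qed
  have right: "real n / A \<le> (real K / n) ^ r * (1 - real K / n) ^ s"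
  proof (rule bound_of_mode)
    have "2 * K + 1 = 2 + r" using assms by (simp add: r_def)
    then show "A * real K ^ r * real (n - K) ^ s
      = 8 * real (n choose K) ^ 2 * real K ^ (2 * K + 1) * real (n - K) ^ (2 * (n - K) + 1)"
      by (simp only: A_def s_def power_add power_mult_distrib mult_ac)
  qed (use assms in auto)
  have F: "real n / A \<le> p ^ r * (1 - p) ^ s"
  \<comment> \<open>For K = 1 the left end point is 0, where the power product vanishes; the
    hypothesis 1 <= n p then forces p = 1/n, the right end point.\<close>
  proof (cases "K = 1")
    case True
    then have "p = real K / n" using assms n by (simp add: field_simps)
    then show ?thesis using right by simp
  next
    case False
    with assms obtain k where k: "K = Suc k" "0 < k" by (cases K) auto
    have left: "real n / A \<le> (real k / n) ^ r * (1 - real k / n) ^ s"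
    proof (rule bound_of_mode)
      \<comment> \<open>Absorption rewrites \<open>A\<close> with (n - k)^2 in place of K^2, which
        supplies the two powers of n - k missing from \<open>s\<close>.\<close>
      have "Suc k * (n choose Suc k) = (n - k) * (n choose k)"
        using binomial_absorb_comp[of n k] binomial_absorption[of k n] by simp
      then have "real K * real (n choose K) = real (n - k) * real (n choose k)"
        by (metis of_nat_mult k(1))
      then have "A = 8 * (real (n choose k))\<^sup>2 * real (n - k) ^ 2"
        by (simp add: A_def power_mult_distrib)
      moreover have "r = 2 * k + 1" "2 * (n - k) + 1 = 2 + s"
        using k assms by (simp_all add: r_def s_def)
      ultimately show "A * real k ^ r * real (n - k) ^ s
        = 8 * real (n choose k) ^ 2 * real k ^ (2 * k + 1) * real (n - k) ^ (2 * (n - k) + 1)"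
        by (simp only: power_add mult_ac)
    qed (use assms k in auto)
    show ?thesis
      by (rule min_le_power_mult_power[OF _ _ _ _ _ left right])
         (use assms k n A in \<open>auto simp: field_simps\<close>)
  qed
  have p: "0 < p" using assms n by (metis zero_less_mult_pos less_le_trans zero_less_one)
  have p1: "p < 1"
  proof -
    have "real n * p < real n * 1" using assms by linarith
    then show ?thesis using n by (simp only: mult_less_cancel_left_pos)
  qed
  \<comment> \<open>The factor p (1 - p) makes both exponents even, so that the right side becomes
    twice a square.\<close>
  have "real n * p * (1 - p) \<le> A * (p ^ r * (1 - p) ^ s) * (p * (1 - p))"
  proof -
    have "real n \<le> A * (p ^ r * (1 - p) ^ s)"
      using F A by (simp add: field_simps)
    from mult_right_mono[OF this, of "p * (1 - p)"] show ?thesis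
      using p p1 by (simp add: mult.assoc)
  qed
  also have "\<dots> = A * (p ^ (r + 1)) * (1 - p) ^ (s + 1)"
    by (simp add: mult_ac)
  also have "\<dots> = 2 * (2 * de_Moivre_term n p K)\<^sup>2"
  proof -
    have "r + 1 = K * 2" "s + 1 = (n + 1 - K) * 2"
      using assms by (simp_all add: r_def s_def)
    then show ?thesis
      by (simp only: A_def de_Moivre_term_def power_mult power_mult_distrib) simp
  qed
  finally show ?thesis
    using p p1 by (intro real_le_lsqrt) (auto simp: de_Moivre_term_def)
qed

section \<open>Both bounds for the random variable\<close>

theorem lemma2p5:
  fixes n :: nat and p :: real and M :: "'a measure" and Y :: "'a \<Rightarrow> nat"
  assumes "n \<ge> 2"
    and "p \<in> {1 / real n .. 1 - 1 / real n}"
    and "prob_space M"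
    and "Y \<in> measurable M (count_space UNIV)"
    and "distr M (count_space UNIV) Y = measure_pmf (binomial_pmf n p)"
  shows "sqrt (real n * p * (1 - p) / 2) \<le> prob_space.expectation M (\<lambda>\<omega>. \<bar>real (Y \<omega>) - real n * p\<bar>)
       \<and> prob_space.expectation M (\<lambda>\<omega>. \<bar>real (Y \<omega>) - real n * p\<bar>) \<le> sqrt (real n * p * (1 - p))"
proof -
  have n: "0 < real n" using assms(1) by simp
  have np: "1 \<le> real n * p" "real n * p \<le> real n - 1"
    using assms(2) n by (auto simp: field_simps)
  have "0 < 1 / real n" using n by simp
  with assms(2) have p: "0 < p" "p < 1" unfolding atLeastAtMost_iff by linarith+
  have "prob_space.expectation M (\<lambda>\<omega>. \<bar>real (Y \<omega>) - real n * p\<bar>)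
      = integral\<^sup>L (distr M (count_space UNIV) Y) (\<lambda>j. \<bar>real j - real n * p\<bar>)"
    using assms(4) by (subst integral_distr) auto
  also have "\<dots> = (\<Sum>j\<le>n. \<bar>real j - real n * p\<bar> * Bernstein n j p)"
    using p by (simp add: assms(5) binomial_expectation_eq_Bernstein_sum)
  finally have E: "prob_space.expectation M (\<lambda>\<omega>. \<bar>real (Y \<omega>) - real n * p\<bar>) = \<dots>" .
  \<comment> \<open>The range of \<open>p\<close> gives 1 <= n p <= n - 1, so this ceiling lies
    strictly between 0 and \<open>n\<close>.\<close>
  define K where "K = nat \<lceil>real n * p\<rceil>"
  have K: "real K - 1 \<le> real n * p" "real n * p \<le> real K"
    using np unfolding K_def by linarith+
  have "K \<noteq> 0" using K np by (intro notI) simp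
  moreover have "\<lceil>real n * p\<rceil> \<le> int n - 1"
    using np by (intro ceiling_le) simp
  then have "K < n" using assms(1) unfolding K_def by linarith
  ultimately have lower: "sqrt (real n * p * (1 - p) / 2)
      \<le> (\<Sum>j\<le>n. \<bar>real j - real n * p\<bar> * Bernstein n j p)"
    using K np by (subst binomial_mean_absolute_deviation[of K]) (auto intro: de_Moivre_term_lower_bound)
  define \<sigma> where "\<sigma> = sqrt (real n * p * (1 - p))"
  have \<sigma>: "0 < \<sigma>" "\<sigma>\<^sup>2 = real n * p * (1 - p)"
    using n p by (simp_all add: \<sigma>_def)
  have "2 * \<sigma> * (\<Sum>j\<le>n. \<bar>real j - real n * p\<bar> * Bernstein n j p)
      = (\<Sum>j\<le>n. 2 * \<sigma> * \<bar>real j - real n * p\<bar> * Bernstein n j p)"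
    by (simp add: sum_distrib_left mult.assoc)
  also have "\<dots> \<le> (\<Sum>j\<le>n. ((real j - real n * p)\<^sup>2 + \<sigma>\<^sup>2) * Bernstein n j p)"
  proof (intro sum_mono mult_right_mono)
    fix j
    show "2 * \<sigma> * \<bar>real j - real n * p\<bar> \<le> (real j - real n * p)\<^sup>2 + \<sigma>\<^sup>2"
      using sum_squares_bound[of \<sigma> "\<bar>real j - real n * p\<bar>"] by simp
  qed (use p in \<open>auto intro: Bernstein_nonneg\<close>)
  also have "\<dots> = (\<Sum>j\<le>n. (real j - real n * p)\<^sup>2 * Bernstein n j p)
      + \<sigma>\<^sup>2 * (\<Sum>j\<le>n. Bernstein n j p)"
    by (simp add: distrib_right sum.distrib flip: sum_distrib_left)
  also have "(\<Sum>j\<le>n. (real j - real n * p)\<^sup>2 * Bernstein n j p) = \<sigma>\<^sup>2"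
  proof -
    \<comment> \<open>The square is split as j (j - 1) + (1 - 2 n p) j + (n p)^2 to match the known
      factorial moments of the Bernstein polynomials.\<close>
    have "(\<Sum>j\<le>n. (real j - real n * p)\<^sup>2 * Bernstein n j p)
        = (\<Sum>j\<le>n. real j * (real j - 1) * Bernstein n j p)
          + (1 - 2 * (real n * p)) * (\<Sum>j\<le>n. real j * Bernstein n j p)
          + (real n * p)\<^sup>2 * (\<Sum>j\<le>n. Bernstein n j p)"
      unfolding sum_distrib_left sum.distrib[symmetric]
      by (intro sum.cong) (auto simp: algebra_simps power2_eq_square)
    then show ?thesis
      by (simp add: sum_k_Bernstein sum_kk_Bernstein \<sigma>) (simp add: algebra_simps power2_eq_square)
  qed
  also have "\<sigma>\<^sup>2 + \<sigma>\<^sup>2 * (\<Sum>j\<le>n. Bernstein n j p) = 2 * \<sigma> * \<sigma>"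
    by (simp add: power2_eq_square)
  finally have "(\<Sum>j\<le>n. \<bar>real j - real n * p\<bar> * Bernstein n j p) \<le> \<sigma>"
    using \<sigma>(1) by (simp add: mult_le_cancel_left_pos)
  with lower show ?thesis
    by (simp add: E \<sigma>_def)
qed

end
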